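(* Let $b\ge2$ be an integer, let $\mathcal{C}\subset\mathbb{Z}$ with $0\in\mathcal{C}$ be a complete set of representatives of the group $\mathbb{Z}/b\mathbb{Z}$, and let $t\in\mathbb{N}$ with $\gcd(t,b)=1$. Then $$\mathbb{Z}=\bigcup_{n=1}^\infty\left(t\mathcal{C}+bt\mathcal{C}+\cdots+b^{n-1}t\mathcal{C}-b^n\bigl(T(b,t\mathcal{C})\cap\mathbb{Z}\bigr)\right).$$
   Context: $\mathbb{N}=\{1,2,\ldots\}$. A complete set of representatives contains exactly one element of each residue class modulo $b$. $T(b,t\mathcal{C})=\left\{\sum_{j=1}^\infty tc_jb^{-j}: c_j\in\mathcal{C}\right\}$. Sums and differences of sets are Minkowski sums and differences. *)

theory Defs
  imports "HOL-Analysis.Analysis" "HOL-Library.Set_Algebras" "HOL-Number_Theory.Cong"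
begin

definition complete_residue_system :: "int \<Rightarrow> int set \<Rightarrow> bool" where
  "complete_residue_system b C \<longleftrightarrow> (\<forall>r. \<exists>!c. c \<in> C \<and> [c = r] (mod b))"

(* The digit d j is the coefficient of b^-(j+1), because sequences here start at index 0
   while the digits of the mathematical series start at index 1. *)
definition radix_fractions :: "int \<Rightarrow> int set \<Rightarrow> real set" where
  "radix_fractions b D =
     {(\<Sum>j. real_of_int (d j) / real_of_int b ^ (j + 1)) | d. \<forall>j. d j \<in> D}"

(* Elementwise differences; the operator - on sets is the set-theoretic difference,
   whereas + and the sum over an index range below are the Minkowski operations of
   Set_Algebras. *)
definition minkowski_diff :: "int set \<Rightarrow> int set \<Rightarrow> int set"  (infixl "\<ominus>" 65) where
  "A \<ominus> B = {x - y | x y. x \<in> A \<and> y \<in> B}"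

end

theory Submission
  imports Defs
begin

text \<open>Expanding an integer \<open>z\<close> from the low end, \<open>z = d\<^sub>0 + b z\<^sub>1\<close>, \<open>z\<^sub>1 = d\<^sub>1 + b z\<^sub>2\<close>, \<open>\<dots>\<close>
  with digits in the finite set \<open>D = t C\<close>, gives a bounded and hence eventually periodic orbit.
  A point \<open>w\<close> on the cycle can be followed backwards forever: iterating
  \<open>- z\<^sub>k\<^sub>+\<^sub>1 = d\<^sub>k / b - z\<^sub>k / b\<close> along the cycle expands \<open>- w\<close> as a radix fraction, since the
  remainder stays bounded while being divided by ever higher powers of \<open>b\<close>. Stopping the forward
  expansion of \<open>z\<close> at \<open>w\<close> yields the representation.\<close>

lemma complete_residue_system_finite:
  assumes "b \<ge> 2" "complete_residue_system b C"
  shows "finite C"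
proof (rule inj_on_finite)
  show "inj_on (\<lambda>c. c mod b) C"
    using assms(2) unfolding complete_residue_system_def cong_def inj_on_def by metis
  show "(\<lambda>c. c mod b) ` C \<subseteq> {0..<b}"
    using assms(1) by auto
qed simp

text \<open>Coprimality makes \<open>t\<close> invertible modulo \<open>b\<close>; with an inverse
  \<open>s\<close>, the representative of \<open>s * r\<close> is carried by \<open>t\<close> into
  the class of \<open>r\<close>.\<close>

lemma complete_residue_system_scale_covers:
  assumes "complete_residue_system b C" "coprime t b"
  shows "\<exists>d\<in>t *o C. b dvd r - d"
proof -
  obtain s where s: "[t * s = 1] (mod b)"
    using assms(2) cong_solve_coprime_int by blast
  obtain c where c: "c \<in> C" "[c = s * r] (mod b)"
    using assms(1) unfolding complete_residue_system_def by blast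
  have "[t * c = t * (s * r)] (mod b)"
    using c(2) by (rule cong_scalar_left)
  also have "t * (s * r) = t * s * r" by simp
  also have "[t * s * r = 1 * r] (mod b)"
    using s by (rule cong_scalar_right)
  finally have "b dvd r - t * c"
    by (simp add: cong_iff_dvd_diff dvd_diff_commute)
  with c(1) show ?thesis
    by (auto simp: elt_set_times_def)
qed

lemma sum_in_set_sum:
  fixes n :: nat
  assumes "\<And>k. k < n \<Longrightarrow> a k \<in> A k"
  shows "(\<Sum>k<n. a k) \<in> (\<Sum>k<n. A k)"
  using assms by (induction n) auto

lemma finite_int_abs_bound:
  fixes A :: "int set"
  assumes "finite A"
  obtains M where "\<And>x. x \<in> A \<Longrightarrow> \<bar>x\<bar> \<le> M"
proof
  show "\<And>x. x \<in> A \<Longrightarrow> \<bar>x\<bar> \<le> (\<Sum>x\<in>A. \<bar>x\<bar>)"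
    using assms by (intro member_le_sum) auto
qed

text \<open>Passing from \<open>z n\<close> to \<open>z (Suc n)\<close> subtracts a digit and
  divides by \<open>b \<ge> 2\<close>; subtraction at most doubles the bound and division at least
  halves it again.\<close>

lemma expansion_bounded:
  fixes b M :: int and z d :: "nat \<Rightarrow> int"
  assumes "b \<ge> 2" "\<And>n. z n = d n + b * z (Suc n)" "\<And>n. \<bar>d n\<bar> \<le> M"
  shows "\<bar>z n\<bar> \<le> max \<bar>z 0\<bar> M"
proof (induction n)
  case (Suc n)
  have "2 * \<bar>z (Suc n)\<bar> \<le> b * \<bar>z (Suc n)\<bar>"
    using assms(1) by (intro mult_right_mono) auto
  also have "\<dots> = \<bar>z n - d n\<bar>"
    using assms(1) by (simp add: assms(2)[of n] abs_mult)
  also have "\<dots> \<le> 2 * max \<bar>z 0\<bar> M"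
    using Suc assms(3)[of n] by linarith
  finally show ?case by simp
qed simp

lemma expansion_truncate:
  fixes b :: int and z d :: "nat \<Rightarrow> int"
  assumes "\<And>n. z n = d n + b * z (Suc n)"
  shows "z 0 = (\<Sum>k<n. b ^ k * d k) + b ^ n * z n"
proof (induction n)
  case (Suc n)
  then show ?case
    using assms[of n] by (simp add: algebra_simps)
qed simp

lemma backward_orbit_radix_fraction:
  fixes b :: int and u d :: "nat \<Rightarrow> int"
  assumes "b \<ge> 2" "\<And>j. u (Suc j) = d j + b * u j" "\<And>j. d j \<in> D" "finite (range u)"
  shows "real_of_int (- u 0) \<in> radix_fractions b D"
proof -
  let ?b = "real_of_int b" and ?f = "\<lambda>j. real_of_int (d j) / real_of_int b ^ (j + 1)"
  have b: "?b > 1" using assms(1) by simp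
  \<comment> \<open>Dividing the recurrence by \<open>b ^ (j + 1)\<close> turns each term into a
    difference of consecutive values of \<open>u j / b ^ j\<close>, so the sum telescopes.\<close>
  have partial: "(\<Sum>j<n. ?f j) = real_of_int (u n) / ?b ^ n - real_of_int (u 0)" for n
  proof (induction n)
    case (Suc n)
    have "real_of_int (u n) / ?b ^ n + ?f n = real_of_int (u (Suc n)) / ?b ^ Suc n"
      using b by (simp add: assms(2) field_simps)
    with Suc show ?case by (simp del: power_Suc)
  qed simp
  obtain M where M: "\<And>j. \<bar>u j\<bar> \<le> M"
    using finite_int_abs_bound[OF assms(4)] by (metis rangeI)
  have "(\<lambda>n. real_of_int (u n) / ?b ^ n) \<longlonglongrightarrow> 0"
  proof (rule Lim_null_comparison)
    show "(\<lambda>n. real_of_int M / ?b ^ n) \<longlonglongrightarrow> 0"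
      using b by (rule LIMSEQ_divide_realpow_zero)
    show "\<forall>\<^sub>F n in sequentially. norm (real_of_int (u n) / ?b ^ n) \<le> real_of_int M / ?b ^ n"
    proof (intro always_eventually allI)
      fix n
      have "\<bar>real_of_int (u n)\<bar> \<le> real_of_int M"
        using M[of n] by linarith
      then show "norm (real_of_int (u n) / ?b ^ n) \<le> real_of_int M / ?b ^ n"
        using b by (simp add: divide_right_mono)
    qed
  qed
  then have "(\<lambda>n. \<Sum>j<n. ?f j) \<longlonglongrightarrow> 0 - real_of_int (u 0)"
    unfolding partial by (intro tendsto_intros)
  then have "?f sums real_of_int (- u 0)"
    by (simp add: sums_def)
  then have "real_of_int (- u 0) = (\<Sum>j. ?f j)"
    by (rule sums_unique)
  then show ?thesis
    using assms(3) unfolding radix_fractions_def by blast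
qed

text \<open>The elementwise core of the theorem, for any finite digit set meeting every residue
  class.\<close>

lemma int_as_digits_minus_radix_fraction:
  fixes b x :: int and D :: "int set"
  assumes b: "b \<ge> 2" and fin: "finite D" and cover: "\<And>r. \<exists>d\<in>D. b dvd r - d"
  shows "\<exists>n\<ge>1. \<exists>d w. (\<forall>k. d k \<in> D) \<and> real_of_int w \<in> radix_fractions b D \<and>
    x = (\<Sum>k<n. b ^ k * d k) - b ^ n * w"
proof -
  obtain \<delta> where \<delta>: "\<And>r. \<delta> r \<in> D" "\<And>r. b dvd r - \<delta> r"
    using cover by metis
  define f where "f r = (r - \<delta> r) div b" for r
  have step: "r = \<delta> r + b * f r" for r
    using \<delta>(2)[of r] by (simp add: f_def)
  define z where "z n = (f ^^ n) x" for n
  have z_Suc: "z (Suc n) = f (z n)" for n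
    by (simp add: z_def)
  have z_step: "z n = \<delta> (z n) + b * z (Suc n)" for n
    unfolding z_Suc by (rule step)
  obtain M where "\<And>y. y \<in> D \<Longrightarrow> \<bar>y\<bar> \<le> M"
    using finite_int_abs_bound[OF fin] by blast
  then have "\<bar>\<delta> (z n)\<bar> \<le> M" for n
    using \<delta>(1) by blast
  then have "\<bar>z n\<bar> \<le> max \<bar>z 0\<bar> M" for n
    by (rule expansion_bounded[of b z "\<lambda>n. \<delta> (z n)" M, OF b z_step])
  then obtain K where "\<And>n. \<bar>z n\<bar> \<le> K" by blast
  \<comment> \<open>Index 0 is left out so that the cycle is entered at some
    \<open>m \<ge> 1\<close>, as the range of \<open>n\<close> demands.\<close>
  then have "z ` {1..} \<subseteq> {- K..K}"
    by (metis abs_le_iff atLeastAtMost_iff image_subsetI minus_le_iff)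
  then have "finite (z ` {1..})"
    by (rule finite_subset) simp
  then have "\<not> inj_on z {1..}"
    using finite_imageD infinite_Ici by blast
  then obtain m p where "1 \<le> m" "m < p" and period: "z m = z p"
    unfolding inj_on_def by (metis atLeast_iff linorder_neqE_nat)
  define A where "A = z ` {m..<p}"
  have "\<exists>v\<in>A. f v = w" if w: "w \<in> A" for w
  proof -
    obtain j where j: "m \<le> j" "j < p" "w = z j"
      using w by (auto simp: A_def)
    \<comment> \<open>The entry point \<open>z m\<close> is read as \<open>z p\<close>, so that its
      predecessor \<open>z (p - 1)\<close> also lies on the cycle.\<close>
    define i where "i = (if j = m then p else j)"
    have "m < i" "i \<le> p" "w = z i"
      using j \<open>m < p\<close> period by (auto simp: i_def)
    then have "i - 1 \<in> {m..<p}" "f (z (i - 1)) = w"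
      using z_Suc[of "i - 1"] by auto
    then show ?thesis unfolding A_def by blast
  qed
  \<comment> \<open>\<open>g\<close> is a right inverse of \<open>f\<close> on the cycle; iterating
    it from \<open>z m\<close> gives the infinite backward orbit \<open>u\<close>.\<close>
  then obtain g where g: "\<And>w. w \<in> A \<Longrightarrow> g w \<in> A" "\<And>w. w \<in> A \<Longrightarrow> f (g w) = w"
    by metis
  define u where "u j = (g ^^ j) (z m)" for j
  have u_A: "u j \<in> A" for j
    by (induction j) (use \<open>m < p\<close> g(1) in \<open>auto simp: u_def A_def\<close>)
  \<comment> \<open>Since \<open>f\<close> maps \<open>u (Suc j)\<close> to \<open>u j\<close>, the
    digit at position \<open>j\<close> is the one removed from \<open>u (Suc j)\<close>.\<close>
  have "u (Suc j) = \<delta> (u (Suc j)) + b * u j" for j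
    using step[of "u (Suc j)"] g(2)[OF u_A[of j]] by (simp add: u_def)
  moreover have "finite (range u)"
    by (rule finite_subset[of _ A]) (use u_A in \<open>auto simp: A_def\<close>)
  ultimately have "real_of_int (- u 0) \<in> radix_fractions b D"
    by (intro backward_orbit_radix_fraction[of b u "\<lambda>j. \<delta> (u (Suc j))"] b \<delta>(1))
  \<comment> \<open>The forward expansion stops at \<open>z m = u 0\<close>, where the backward
    orbit starts, which makes \<open>- u 0\<close> the witness for \<open>w\<close>.\<close>
  moreover have "x = (\<Sum>k<m. b ^ k * \<delta> (z k)) - b ^ m * (- u 0)"
    using expansion_truncate[of z "\<lambda>k. \<delta> (z k)" b m, OF z_step] by (simp add: z_def u_def)
  moreover have "\<forall>k. \<delta> (z k) \<in> D"
    using \<delta>(1) by blast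
  ultimately show ?thesis
    using \<open>1 \<le> m\<close> by (intro exI[of _ m] exI[of _ "\<lambda>k. \<delta> (z k)"] exI[of _ "- u 0"] conjI)
qed

theorem theorem1p9:
  fixes b t :: int and C :: "int set"
  assumes "b \<ge> 2"
    and "0 \<in> C"
    and "complete_residue_system b C"
    and "t \<ge> 1"
    and "coprime t b"
  shows "(UNIV :: int set) =
    (\<Union>n\<in>{1::nat..}. (\<Sum>k<n. (b ^ k) *o (t *o C)) \<ominus>
        (b ^ n) *o {z. real_of_int z \<in> radix_fractions b (t *o C)})"
proof (intro equalityI subsetI UNIV_I)
  fix x :: int
  have "finite (t *o C)"
    using complete_residue_system_finite[OF assms(1,3)]
    by (auto simp: elt_set_times_def)
  then obtain n d w where n: "n \<ge> 1" and d: "\<And>k. d k \<in> t *o C"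
    and w: "real_of_int w \<in> radix_fractions b (t *o C)"
    and x: "x = (\<Sum>k<n. b ^ k * d k) - b ^ n * w"
    using int_as_digits_minus_radix_fraction[of b "t *o C" x] assms(1)
      complete_residue_system_scale_covers[OF assms(3,5)] by blast
  have "(\<Sum>k<n. b ^ k * d k) \<in> (\<Sum>k<n. (b ^ k) *o (t *o C))"
    using d by (intro sum_in_set_sum set_times_intro2)
  moreover have "b ^ n * w \<in> (b ^ n) *o {z. real_of_int z \<in> radix_fractions b (t *o C)}"
    using w by (intro set_times_intro2) simp
  ultimately have "x \<in> (\<Sum>k<n. (b ^ k) *o (t *o C)) \<ominus>
      (b ^ n) *o {z. real_of_int z \<in> radix_fractions b (t *o C)}"
    unfolding minkowski_diff_def x by blast
  with n show "x \<in> (\<Union>n\<in>{1::nat..}. (\<Sum>k<n. (b ^ k) *o (t *o C)) \<ominus>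
      (b ^ n) *o {z. real_of_int z \<in> radix_fractions b (t *o C)})"
    by blast
qed

end
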